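(* There exist absolute constants $c>0$ and $c'>0$ such that for every sufficiently large $n$ there exist four $n$-pencils in the real projective plane, whose four centres do not all lie on a single line, which determine at least $c' n^{3/2} (\log n)^{c}$ $4$-rich points.
   Context: An $n$-pencil with centre $p \in P^2(\mathbb{R})$ is a set of $n$ distinct concurrent lines all passing through $p$. Given four pencils, a point is called $4$-rich if it lies on at least one line from each of the four pencils. *)

theory Defs
  imports "HOL-Analysis.Analysis"
begin

text \<open>
  Points and lines of the real projective plane are the one- and two-dimensional linear
  subspaces of \<open>\<real>\<^sup>3\<close>; a point \<open>p\<close> lies on a line \<open>l\<close> iff \<open>p \<subseteq> l\<close>.
\<close>

definition proj_point :: "(real^3) set \<Rightarrow> bool" where
  "proj_point p \<longleftrightarrow> subspace p \<and> dim p = 1"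

definition proj_line :: "(real^3) set \<Rightarrow> bool" where
  "proj_line l \<longleftrightarrow> subspace l \<and> dim l = 2"

definition lies_on :: "(real^3) set \<Rightarrow> (real^3) set \<Rightarrow> bool" where
  "lies_on p l \<longleftrightarrow> proj_point p \<and> proj_line l \<and> p \<subseteq> l"

definition n_pencil :: "nat \<Rightarrow> (real^3) set \<Rightarrow> (real^3) set set \<Rightarrow> bool" where
  "n_pencil n p L \<longleftrightarrow> proj_point p \<and> finite L \<and> card L = n \<and> (\<forall>l\<in>L. lies_on p l)"

text \<open>The four pencils are the values of \<open>L\<close> at the indices \<open>0, 1, 2, 3\<close>.\<close>

definition four_rich_points :: "(nat \<Rightarrow> (real^3) set set) \<Rightarrow> (real^3) set set" where
  "four_rich_points L = {q. proj_point q \<and> (\<forall>i<4. \<exists>l\<in>L i. lies_on q l)}"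

end

theory Submission
  imports Defs
begin

text \<open>
  Put the centres at \<open>(1:0:0)\<close>, \<open>(0:1:0)\<close>, \<open>(1:-1:0)\<close> and \<open>(0:0:1)\<close>. An affine point \<open>(x, y)\<close> is
  then \<open>4\<close>-rich as soon as \<open>x\<close>, \<open>y\<close>, \<open>x + y\<close> and \<open>y / x\<close> lie in prescribed sets of size \<open>n\<close>.
  The points are \<open>(k p, k q)\<close> with \<open>k \<le> X\<close> and coprime \<open>p, q \<le> M = \<lfloor>\<surd>n\<rfloor>\<close>: there are at most
  \<open>M\<^sup>2\<close> slopes \<open>q / p\<close>, while \<open>k p\<close>, \<open>k q\<close> and \<open>k (p + q)\<close> are entries of an \<open>X \<times> 2M\<close>
  multiplication table. By Erdos, such a table has only \<open>O(X M / (log n)\<^sup>\<delta>)\<close> distinct entries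
  (once sparse exceptional sets of \<open>k\<close>, \<open>p\<close>, \<open>q\<close> are removed), so \<open>X\<close> may be
  taken as large as \<open>\<surd>n (log n)\<^sup>\<delta>\<close>.

  For the table, let \<open>T\<close> be the set of primes in \<open>[10, M]\<close> and \<open>L = \<Sum>p\<in>T. 1 / p\<close>. Turan's variance
  bound shows that most integers have at least \<open>9L/10\<close> prime factors from \<open>T\<close>, so that most products
  have at least \<open>9L/5\<close>; Rankin's method shows that this holds for at most a fraction
  \<open>exp (- L / 25)\<close> of all integers. The Euler product gives \<open>L \<ge> (ln ln M) / 2 - 4\<close>.
\<close>

subsection \<open>Prime factors from a finite set of primes\<close>

text \<open>The arithmetic function Omega restricted to the primes in \<open>T\<close>. Counting
  with multiplicity makes it completely additive on positive integers.\<close>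

definition prime_mult :: "nat set \<Rightarrow> nat \<Rightarrow> nat" where
  "prime_mult T m = (\<Sum>p\<in>T. multiplicity p m)"

lemma multiples_atMost_eq:
  assumes "d > 0"
  shows "{m\<in>{1..x::nat}. d dvd m} = (*) d ` {1..x div d}"
proof (intro equalityI subsetI)
  fix m assume "m \<in> {m\<in>{1..x}. d dvd m}"
  then obtain k where k: "m = d * k" "1 \<le> m" "m \<le> x" by auto
  then have "1 \<le> k" by (cases k) auto
  moreover have "k \<le> x div d" using k assms by (simp add: less_eq_div_iff_mult_less_eq mult.commute)
  ultimately show "m \<in> (*) d ` {1..x div d}" using k by auto
next
  fix m assume "m \<in> (*) d ` {1..x div d}"
  then obtain k where "m = d * k" "1 \<le> k" "k \<le> x div d" by (metis imageE atLeastAtMost_iff)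
  then show "m \<in> {m\<in>{1..x}. d dvd m}"
    using assms by (auto simp: less_eq_div_iff_mult_less_eq mult.commute)
qed

lemma sum_multiples:
  fixes f :: "nat \<Rightarrow> 'a::comm_monoid_add"
  assumes "d > 0"
  shows "(\<Sum>m | m \<in> {1..x} \<and> d dvd m. f m) = (\<Sum>m\<in>{1..x div d}. f (d * m))"
  unfolding multiples_atMost_eq[OF assms]
  using assms by (subst sum.reindex) (auto simp: inj_on_def)

lemma card_multiples:
  assumes "d > 0"
  shows "card {m\<in>{1..x::nat}. d dvd m} = x div d"
  unfolding multiples_atMost_eq[OF assms] using assms by (simp add: card_image inj_on_def)

lemma prime_mult_mult:
  assumes "\<And>p. p \<in> T \<Longrightarrow> prime p" "a > 0" "b > 0"
  shows "prime_mult T (a * b) = prime_mult T a + prime_mult T b"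
  unfolding prime_mult_def
  using assms by (simp add: prime_elem_multiplicity_mult_distrib sum.distrib)

lemma prime_mult_insert_dvd:
  assumes "prime p" "p \<notin> T" "finite T" "\<And>q. q \<in> T \<Longrightarrow> prime q" "m > 0"
  shows "prime_mult (insert p T) (p * m) = Suc (prime_mult (insert p T) m)"
    and "prime_mult T (p * m) = prime_mult T m"
proof -
  have "multiplicity q p = 0" if "q \<in> T" for q
    using assms that by (metis not_dvd_imp_multiplicity_0 primes_dvd_imp_eq)
  then have "prime_mult T p = 0" unfolding prime_mult_def by simp
  then show 1: "prime_mult T (p * m) = prime_mult T m"
    using prime_mult_mult[of T p m] assms by (auto simp: prime_gt_0_nat)
  have "multiplicity p (p * m) = Suc (multiplicity p m)"
    using assms(1,5) by (intro multiplicity_times_same) auto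
  then show "prime_mult (insert p T) (p * m) = Suc (prime_mult (insert p T) m)"
    using 1 assms unfolding prime_mult_def by simp
qed

text \<open>The factor at \<open>p\<close> equals
  \<open>(1 - 1/p) * (1 + z/p + (z/p)^2 + ...)\<close>, the mean value of
  \<open>z ^ multiplicity p m\<close>; \<open>p > z\<close> is the convergence of this series. The
  induction splits off one prime at a time.\<close>

lemma sum_power_prime_mult_le:
  fixes z :: real
  assumes "finite T" "\<And>p. p \<in> T \<Longrightarrow> prime p" "z \<ge> 1" "\<And>p. p \<in> T \<Longrightarrow> real p > z"
  shows "(\<Sum>m\<in>{1..x}. z ^ prime_mult T m) \<le> real x * (\<Prod>p\<in>T. 1 + (z - 1) / (real p - z))"
  using assms(1,2,4)
proof (induction T arbitrary: x)
  case empty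
  then show ?case by (simp add: prime_mult_def)
next
  case (insert p T)
  define C where "C = (\<Prod>p\<in>T. 1 + (z - 1) / (real p - z))"
  define F where "F x = (\<Sum>m\<in>{1..x}. z ^ prime_mult (insert p T) m)" for x
  define G where "G x = (\<Sum>m\<in>{1..x}. z ^ prime_mult T m)" for x
  have p: "prime p" "real p > z" using insert.prems by auto
  have p1: "p > 1" "p > 0" using p prime_gt_1_nat prime_gt_0_nat by blast+
  have G: "G x \<le> real x * C" for x
    using insert unfolding G_def C_def by auto
  have C: "C \<ge> 0" unfolding C_def using insert.prems assms(3) by (intro prod_nonneg) (simp add: less_imp_le)
  have split: "(\<Sum>m\<in>{1..x}. f m) = (\<Sum>m | m \<in> {1..x} \<and> \<not> p dvd m. f m) + (\<Sum>m\<in>{1..x div p}. f (p * m))"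
    for f :: "nat \<Rightarrow> real" and x
  proof -
    have "(\<Sum>m\<in>{1..x}. f m) = (\<Sum>m\<in>{m. m \<in> {1..x} \<and> \<not> p dvd m} \<union> {m. m \<in> {1..x} \<and> p dvd m}. f m)"
      by (rule sum.cong) auto
    also have "\<dots> = (\<Sum>m | m \<in> {1..x} \<and> \<not> p dvd m. f m) + (\<Sum>m | m \<in> {1..x} \<and> p dvd m. f m)"
      by (rule sum.union_disjoint) auto
    finally show ?thesis using sum_multiples[of p f x] p1 by simp
  qed
  have nd: "prime_mult (insert p T) m = prime_mult T m" if "\<not> p dvd m" for m
    using insert.hyps that by (simp add: prime_mult_def not_dvd_imp_multiplicity_0)
  \<comment> \<open>The \<open>m\<close> not divisible by \<open>p\<close> contribute equally to
    \<open>F\<close> and \<open>G\<close> and cancel.\<close>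
  have rec: "F x - G x = z * F (x div p) - G (x div p)" for x
  proof -
    have a: "F x = (\<Sum>m | m \<in> {1..x} \<and> \<not> p dvd m. z ^ prime_mult T m) + z * F (x div p)"
      unfolding F_def by (subst split) (simp add: nd prime_mult_insert_dvd insert p1 p sum_distrib_left)
    have b: "G x = (\<Sum>m | m \<in> {1..x} \<and> \<not> p dvd m. z ^ prime_mult T m) + G (x div p)"
      unfolding G_def by (subst split) (simp add: prime_mult_insert_dvd insert p1 p)
    show ?thesis using a b by simp
  qed
  text \<open>Inducting on \<open>F - G\<close> instead of \<open>F\<close> gives the factor \<open>z - 1\<close> rather than \<open>z\<close>, which the
    saving in the multiplication table needs.\<close>
  have U: "F x - G x \<le> real x * C * ((z - 1) / (real p - z))" for x
  proof (induction x rule: less_induct)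
    case (less x)
    show ?case
    proof (cases "x = 0")
      case True then show ?thesis by (simp add: F_def G_def)
    next
      case False
      define y where "y = x div p"
      have "y < x" using False p1 by (simp add: y_def)
      have y: "real y \<le> real x / real p" unfolding y_def by (rule of_nat_div_le_of_nat)
      have "F x - G x = z * (F y - G y) + (z - 1) * G y"
        using rec[of x] by (simp add: y_def algebra_simps)
      also have "\<dots> \<le> z * (real y * C * ((z - 1) / (real p - z))) + (z - 1) * (real y * C)"
        using less[OF \<open>y < x\<close>] G[of y] assms(3) by (intro add_mono mult_left_mono) auto
      \<comment> \<open>\<open>u = (z - 1) / (p - z)\<close> solves
        \<open>z * u + (z - 1) = p * u\<close>; the factor \<open>p\<close> is then absorbed by
        \<open>y <= x / p\<close>.\<close>
      also have "\<dots> = real y * (C * ((z - 1) * p / (real p - z)))"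
        using p by (simp add: field_simps)
      also have "\<dots> \<le> real x / real p * (C * ((z - 1) * p / (real p - z)))"
        using y C p assms(3) by (intro mult_right_mono) auto
      also have "\<dots> = real x * C * ((z - 1) / (real p - z))"
        using p1 by simp
      finally show ?thesis .
    qed
  qed
  have "F x \<le> real x * C + real x * C * ((z - 1) / (real p - z))"
    using U[of x] G[of x] by simp
  also have "\<dots> = real x * (\<Prod>p\<in>insert p T. 1 + (z - 1) / (real p - z))"
    using insert.hyps by (simp add: C_def algebra_simps)
  finally show ?case by (simp add: F_def)
qed

text \<open>Expanding the square leaves the first two moments of the number of distinct prime
  factors from \<open>T\<close>, whose mean is about \<open>L\<close>. In the constant 3, the
  diagonal of the second moment accounts for 1 and rounding in the first moment for 2.\<close>

lemma turan_variance:
  assumes "finite T" "\<And>p. p \<in> T \<Longrightarrow> prime p" "card T \<le> x"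
  defines "L \<equiv> (\<Sum>p\<in>T. 1 / real p)"
  shows "(\<Sum>m\<in>{1..x}. (real (card {p\<in>T. p dvd m}) - L)\<^sup>2) \<le> 3 * real x * L"
proof -
  define w where "w m = (\<Sum>p\<in>T. of_bool (p dvd m) :: real)" for m :: nat
  have w: "real (card {p\<in>T. p dvd m}) = w m" for m
    unfolding w_def using assms(1) by (simp add: of_bool_def sum.If_cases Int_def)
  have pos: "p > 0" if "p \<in> T" for p using assms(2) that prime_gt_0_nat by blast
  have L0: "L \<ge> 0" unfolding L_def by (intro sum_nonneg) auto
  have cnt: "(\<Sum>m\<in>{1..x}. of_bool (d dvd m) :: real) = real (x div d)" if "d > 0" for d
    using card_multiples[OF that, of x] by (simp add: of_bool_def sum.If_cases Int_def)
  \<comment> \<open>Rounding \<open>x / p\<close> down loses at most 1 per prime, hence at most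
    \<open>card T <= x\<close> in all.\<close>
  have s1: "(\<Sum>m\<in>{1..x}. w m) \<ge> real x * L - real x"
  proof -
    have "real x * L - real x \<le> real x * L - real (card T)" using assms(3) by simp
    also have "\<dots> = (\<Sum>p\<in>T. real x / real p - 1)"
      by (simp add: L_def sum_subtractf sum_distrib_left)
    also have "\<dots> \<le> (\<Sum>p\<in>T. real (x div p))"
    proof (intro sum_mono)
      fix p assume "p \<in> T"
      have "real (x div p) = real_of_int \<lfloor>real x / real p\<rfloor>"
        by (simp add: floor_divide_of_nat_eq)
      then show "real x / real p - 1 \<le> real (x div p)" by linarith
    qed
    also have "\<dots> = (\<Sum>p\<in>T. \<Sum>m\<in>{1..x}. of_bool (p dvd m))"
      using cnt pos by (intro sum.cong) auto
    also have "\<dots> = (\<Sum>m\<in>{1..x}. w m)" unfolding w_def by (rule sum.swap)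
    finally show ?thesis .
  qed
  have s2: "(\<Sum>m\<in>{1..x}. (w m)\<^sup>2) \<le> real x * L\<^sup>2 + real x * L"
  proof -
    have "(\<Sum>m\<in>{1..x}. (w m)\<^sup>2) = (\<Sum>m\<in>{1..x}. \<Sum>p\<in>T. \<Sum>q\<in>T. of_bool (p dvd m) * of_bool (q dvd m))"
      by (simp add: w_def power2_eq_square sum_product)
    also have "\<dots> = (\<Sum>p\<in>T. \<Sum>q\<in>T. \<Sum>m\<in>{1..x}. of_bool (p dvd m) * of_bool (q dvd m))"
      by (subst sum.swap, rule sum.cong[OF refl], rule sum.swap)
    \<comment> \<open>Distinct primes are coprime, so joint divisibility is divisibility by
      \<open>p * q\<close>, and rounding down only helps an upper bound.\<close>
    also have "\<dots> \<le> (\<Sum>p\<in>T. \<Sum>q\<in>T. real x * (1 / real p * (1 / real q)) + (if p = q then real x / real p else 0))"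
    proof (intro sum_mono)
      fix p q assume pq: "p \<in> T" "q \<in> T"
      show "(\<Sum>m\<in>{1..x}. of_bool (p dvd m) * of_bool (q dvd m)) \<le> real x * (1 / real p * (1 / real q)) + (if p = q then real x / real p else 0)"
      proof (cases "p = q")
        case True
        have "(\<Sum>m\<in>{1..x}. of_bool (p dvd m) * of_bool (q dvd m)) = (\<Sum>m\<in>{1..x}. of_bool (p dvd m) :: real)"
          using True by (intro sum.cong) auto
        also have "\<dots> \<le> real x / real p" using cnt[OF pos[OF pq(1)]] of_nat_div_le_of_nat[of x p, where ?'a=real] by simp
        finally show ?thesis using True by (simp add: add_increasing)
      next
        case False
        then have "coprime p q" using pq assms(2) by (simp add: primes_coprime)
        then have "p * q dvd m \<longleftrightarrow> p dvd m \<and> q dvd m" for m by (metis divides_mult dvd_mult_left dvd_mult_right)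
        then have "(\<Sum>m\<in>{1..x}. of_bool (p dvd m) * of_bool (q dvd m)) = (\<Sum>m\<in>{1..x}. of_bool (p * q dvd m) :: real)"
          by (intro sum.cong) auto
        also have "\<dots> \<le> real x / real (p * q)"
          using cnt[of "p * q"] pos pq of_nat_div_le_of_nat[of x "p * q", where ?'a=real] by simp
        finally show ?thesis using False by simp
      qed
    qed
    also have "\<dots> = real x * L\<^sup>2 + real x * L"
    proof -
      have "(\<Sum>p\<in>T. \<Sum>q\<in>T. real x * (1 / real p * (1 / real q))) = real x * L\<^sup>2"
        unfolding L_def power2_eq_square sum_product by (simp only: sum_distrib_left)
      moreover have "(\<Sum>p\<in>T. \<Sum>q\<in>T. if p = q then real x / real p else 0) = real x * L"
        using assms(1) by (simp add: L_def sum_distrib_left)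
      ultimately show ?thesis by (simp only: sum.distrib)
    qed
    finally show ?thesis .
  qed
  have "(\<Sum>m\<in>{1..x}. (w m - L)\<^sup>2) = (\<Sum>m\<in>{1..x}. (w m)\<^sup>2) - 2 * L * (\<Sum>m\<in>{1..x}. w m) + real x * L\<^sup>2"
    by (simp add: power2_diff sum.distrib sum_subtractf sum_distrib_left algebra_simps)
  also have "\<dots> \<le> (real x * L\<^sup>2 + real x * L) - 2 * L * (real x * L - real x) + real x * L\<^sup>2"
    using s1 s2 L0 by (intro add_mono diff_mono mult_left_mono) auto
  also have "\<dots> = 3 * real x * L" by (simp add: algebra_simps power2_eq_square)
  finally show ?thesis by (simp add: w)
qed

text \<open>Chebyshev's inequality: \<open>prime_mult\<close> is at least the number of distinct
  prime factors, and a deviation of \<open>L / 10\<close> gives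
  \<open>3 * x * L / (L / 10)^2 = 300 * x / L\<close>.\<close>

lemma card_prime_mult_small:
  assumes "finite T" "\<And>p. p \<in> T \<Longrightarrow> prime p" "card T \<le> x"
  defines "L \<equiv> (\<Sum>p\<in>T. 1 / real p)"
  assumes "L > 0"
  shows "real (card {m\<in>{1..x}. real (prime_mult T m) < 9/10 * L}) \<le> 300 * real x / L"
proof -
  let ?w = "\<lambda>m. real (card {p\<in>T. p dvd m})"
  let ?B = "{m\<in>{1..x}. real (prime_mult T m) < 9/10 * L}"
  have w: "?w m \<le> real (prime_mult T m)" if "m > 0" for m
  proof -
    have "card {p\<in>T. p dvd m} = (\<Sum>p\<in>T. of_bool (p dvd m))"
      using assms(1) by (simp add: of_bool_def sum.If_cases Int_def)
    also have "\<dots> \<le> prime_mult T m"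
      unfolding prime_mult_def
    proof (intro sum_mono)
      fix p assume "p \<in> T"
      then show "of_bool (p dvd m) \<le> multiplicity p m"
        using that assms(2)[of p] prime_multiplicity_gt_zero_iff[of p m]
        by (auto simp: of_bool_def Suc_le_eq)
    qed
    finally show ?thesis by simp
  qed
  have "real (card ?B) * (L / 10)\<^sup>2 = (\<Sum>m\<in>?B. (L / 10)\<^sup>2)" by simp
  also have "\<dots> \<le> (\<Sum>m\<in>?B. (?w m - L)\<^sup>2)"
  proof (intro sum_mono)
    fix m assume "m \<in> ?B"
    then have "?w m < 9/10 * L" using w[of m] by auto
    then show "(L / 10)\<^sup>2 \<le> (?w m - L)\<^sup>2"
      using assms(5) by (subst power2_commute[of "?w m"]) (intro power_mono, auto)
  qed
  also have "\<dots> \<le> (\<Sum>m\<in>{1..x}. (?w m - L)\<^sup>2)" by (intro sum_mono2) auto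
  also have "\<dots> \<le> 3 * real x * L" unfolding L_def using turan_variance assms(1-3) by blast
  finally have "real (card ?B) * (L / 10)\<^sup>2 \<le> 3 * real x * L" .
  then show ?thesis using assms(5) by (simp add: field_simps power2_eq_square)
qed

section \<open>A lower bound for sums of prime reciprocals\<close>

text \<open>A truncated Euler product, each factor \<open>1 / (1 - 1/p)\<close> being at most
  \<open>1 + 2/p <= exp (2/p)\<close>.\<close>

lemma sum_inverse_smooth_le:
  assumes "finite T" "\<And>p. p \<in> T \<Longrightarrow> prime p"
  shows "(\<Sum>m | m \<in> {1..M} \<and> (\<forall>p. prime p \<longrightarrow> p dvd m \<longrightarrow> p \<in> T). 1 / real m)
           \<le> exp (2 * (\<Sum>p\<in>T. 1 / real p))"
  using assms
proof (induction T)
  case empty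
  have "{m \<in> {1..M}. \<forall>p. prime p \<longrightarrow> p dvd m \<longrightarrow> p \<in> {}} \<subseteq> {1}"
    using prime_factor_nat by auto
  then have "(\<Sum>m | m \<in> {1..M} \<and> (\<forall>p. prime p \<longrightarrow> p dvd m \<longrightarrow> p \<in> {}). 1 / real m) \<le> (\<Sum>m\<in>{1::nat}. 1 / real m)"
    by (intro sum_mono2) auto
  then show ?case by simp
next
  case (insert p T)
  let ?A = "\<lambda>T. {m \<in> {1..M}. \<forall>p. prime p \<longrightarrow> p dvd m \<longrightarrow> p \<in> T}"
  let ?S = "\<lambda>T. (\<Sum>m\<in>?A T. 1 / real m)"
  have p: "prime p" "p \<ge> 2" using insert.prems prime_ge_2_nat by auto
  \<comment> \<open>The truncated set is closed under division by \<open>p\<close>, so the same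
    finite sum reappears with weight \<open>1/p\<close> and can be moved to the left.\<close>
  have sub: "?A (insert p T) \<subseteq> ?A T \<union> (*) p ` ?A (insert p T)"
  proof
    fix m assume m: "m \<in> ?A (insert p T)"
    show "m \<in> ?A T \<union> (*) p ` ?A (insert p T)"
    proof (cases "p dvd m")
      case True
      then obtain k where k: "m = p * k" by auto
      moreover have "k \<noteq> 0" "k \<le> m" using k m p by (auto intro: Nat.gr0I)
      ultimately have "k \<in> ?A (insert p T)" using m k(1) order.trans[of k m M] by auto
      then show ?thesis using k by auto
    next
      case False
      then show ?thesis using m by auto
    qed
  qed
  have "?S (insert p T) \<le> (\<Sum>m\<in>?A T \<union> (*) p ` ?A (insert p T). 1 / real m)"
    using sub by (intro sum_mono2) auto
  also have "\<dots> \<le> ?S T + (\<Sum>m\<in>(*) p ` ?A (insert p T). 1 / real m)"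
    by (subst sum_Un) (auto intro!: sum_nonneg)
  also have "(\<Sum>m\<in>(*) p ` ?A (insert p T). 1 / real m) = (\<Sum>m\<in>?A (insert p T). 1 / real (p * m))"
    using p by (subst sum.reindex) (auto simp: inj_on_def)
  also have "\<dots> = ?S (insert p T) / real p" by (simp add: sum_divide_distrib mult.commute)
  finally have 1: "?S (insert p T) * (1 - 1 / real p) \<le> ?S T" by (simp add: algebra_simps)
  have "1 \<le> (1 + 2 / real p) * (1 - 1 / real p)" using p by (simp add: field_simps)
  moreover have S0: "?S (insert p T) \<ge> 0" by (intro sum_nonneg) auto
  ultimately have "?S (insert p T) \<le> ?S (insert p T) * ((1 + 2 / real p) * (1 - 1 / real p))"
    using mult_left_mono by fastforce
  also have "\<dots> = (1 + 2 / real p) * (?S (insert p T) * (1 - 1 / real p))" by (simp only: ac_simps)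
  also have "\<dots> \<le> exp (2 / real p) * ?S T"
    using 1 p S0 by (intro mult_mono exp_ge_add_one_self) auto
  also have "\<dots> \<le> exp (2 / real p) * exp (2 * (\<Sum>p\<in>T. 1 / real p))"
    using insert by (intro mult_left_mono) auto
  also have "\<dots> = exp (2 * (\<Sum>p\<in>insert p T. 1 / real p))"
    using insert.hyps by (simp add: exp_add[symmetric] algebra_simps)
  finally show ?case .
qed

text \<open>All \<open>m <= M\<close> have only prime factors up to \<open>M\<close>, so the
  harmonic sum is bounded by the Euler product.\<close>

lemma ln_le_exp_sum_prime_inverses:
  assumes "M \<ge> 1"
  shows "ln (real M) \<le> exp (2 * (\<Sum>p | prime p \<and> p \<le> M. 1 / real p))"
proof -
  have "ln (real M) \<le> (\<Sum>m\<in>{1..M}. 1 / real m)"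
  proof -
    have "ln (real M) \<le> ln (real M + 1)" using assms by (subst ln_le_cancel_iff) auto
    then show ?thesis using ln_le_harm[of M] by (simp add: harm_def inverse_eq_divide)
  qed
  also have "\<dots> = (\<Sum>m | m \<in> {1..M} \<and> (\<forall>p. prime p \<longrightarrow> p dvd m \<longrightarrow> p \<in> {p. prime p \<and> p \<le> M}). 1 / real m)"
    by (intro sum.cong) (auto dest!: dvd_imp_le)
  also have "\<dots> \<le> exp (2 * (\<Sum>p | prime p \<and> p \<le> M. 1 / real p))"
    by (rule sum_inverse_smooth_le) auto
  finally show ?thesis .
qed

section \<open>The density of coprime pairs\<close>

lemma sum_inverse_squares_le:
  assumes "M \<ge> 2"
  shows "(\<Sum>d\<in>{2..M::nat}. 1 / (real d)\<^sup>2) \<le> 3 / 4 "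
proof -
  \<comment> \<open>The term \<open>- 1 / M\<close> makes the induction telescope. Equality holds at
    \<open>M = 2\<close>, which keeps the constant below 1.\<close>
  have "(\<Sum>d\<in>{2..M::nat}. 1 / (real d)\<^sup>2) \<le> 3 / 4 - 1 / real M"
    using assms
  proof (induction M rule: dec_induct)
    case (step k)
    have "1 / (real (Suc k))\<^sup>2 \<le> 1 / (real k * real (Suc k))"
      using step by (intro divide_left_mono) (auto simp: power2_eq_square)
    also have "\<dots> = 1 / real k - 1 / real (Suc k)" using step by (simp add: field_simps)
    finally show ?case using step by simp
  qed (simp add: power2_eq_square)
  then show ?thesis by (rule order.trans) simp
qed

text \<open>A union bound over the gcd \<open>d >= 2\<close> of a non-coprime pair: at most
  \<open>(M/d)^2\<close> pairs for each \<open>d\<close>, so at most 3/4 of all pairs.\<close>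

lemma card_coprime_pairs_ge:
  "real (card {(p, q). p \<in> {1..M} \<and> q \<in> {1..M} \<and> coprime p q}) \<ge> (real M)\<^sup>2 / 4"
proof -
  let ?P = "{1..M} \<times> {1..M}"
  let ?C = "{(p, q). p \<in> {1..M} \<and> q \<in> {1..M} \<and> coprime p q}"
  let ?D = "\<lambda>d. {m\<in>{1..M}. d dvd m} \<times> {m\<in>{1..M}. d dvd m}"
  have "?P - ?C \<subseteq> (\<Union>d\<in>{2..M}. ?D d)"
  proof
    fix u assume "u \<in> ?P - ?C"
    then obtain p q where u: "u = (p, q)" "p \<in> {1..M}" "q \<in> {1..M}" "gcd p q \<noteq> 1"
      by (cases u) (auto simp: coprime_iff_gcd_eq_1)
    have "gcd p q \<noteq> 0" "gcd p q \<le> M" using u by (auto intro: order.trans[OF gcd_le1_nat])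
    moreover have "gcd p q \<ge> 2" using u(4) calculation(1) by linarith
    ultimately have "gcd p q \<in> {2..M}" by simp
    moreover have "u \<in> ?D (gcd p q)" using u by auto
    ultimately show "u \<in> (\<Union>d\<in>{2..M}. ?D d)" by blast
  qed
  then have "card (?P - ?C) \<le> card (\<Union>d\<in>{2..M}. ?D d)" by (intro card_mono) auto
  also have "\<dots> \<le> (\<Sum>d\<in>{2..M}. card (?D d))" by (rule card_UN_le) auto
  also have "\<dots> = (\<Sum>d\<in>{2..M}. (M div d)\<^sup>2)"
    by (intro sum.cong) (simp_all add: card_multiples[simplified] card_cartesian_product power2_eq_square)
  finally have "real (card (?P - ?C)) \<le> real (\<Sum>d\<in>{2..M}. (M div d)\<^sup>2)" by (simp only: of_nat_le_iff)
  also have "\<dots> \<le> (\<Sum>d\<in>{2..M}. (real M)\<^sup>2 * (1 / (real d)\<^sup>2))"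
    unfolding of_nat_sum of_nat_power
  proof (intro sum_mono)
    fix d
    have "(real (M div d))\<^sup>2 \<le> (real M / real d)\<^sup>2"
      by (intro power_mono of_nat_div_le_of_nat) auto
    then show "(real (M div d))\<^sup>2 \<le> (real M)\<^sup>2 * (1 / (real d)\<^sup>2)" by (simp add: power_divide)
  qed
  also have "\<dots> = (real M)\<^sup>2 * (\<Sum>d\<in>{2..M}. 1 / (real d)\<^sup>2)" by (simp add: sum_distrib_left)
  also have "\<dots> \<le> (real M)\<^sup>2 * (3 / 4)"
  proof (cases "M \<ge> 2")
    case True
    then show ?thesis using sum_inverse_squares_le[of M] by (intro mult_left_mono) auto
  qed auto
  finally have 1: "real (card (?P - ?C)) \<le> (real M)\<^sup>2 * (3 / 4)" .
  have "card (?P - ?C) = card ?P - card ?C" by (rule card_Diff_subset) (auto intro: finite_subset[of _ ?P])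
  moreover have "card ?C \<le> card ?P" by (rule card_mono) auto
  ultimately have "real (card (?P - ?C)) = (real M)\<^sup>2 - real (card ?C)"
    by (simp add: of_nat_diff power2_eq_square)
  then show ?thesis using 1 by simp
qed

subsection \<open>Few sums and ratios from a multiplication table\<close>

text \<open>Here \<open>63/100 = 9/5 * 35/100\<close>, and 35/100 is a lower bound for
  \<open>ln (3/2)\<close>.\<close>

lemma exp_le_three_halves_powr:
  fixes L :: real
  assumes "L \<ge> 0"
  shows "exp (63/100 * L) \<le> (3/2) powr (9/5 * L)"
proof -
  have "exp (35/100 :: real) \<le> 1 + 35/100 + (35/100)\<^sup>2" by (rule exp_bound) auto
  also have "\<dots> \<le> 3/2" by (simp add: power2_eq_square)
  finally have "35/100 \<le> ln (3/2 :: real)" by (subst ln_ge_iff) auto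
  then have "63/100 * L \<le> 9/5 * L * ln (3/2)" using assms mult_right_mono[of "35/100" "ln (3/2)" "9/5 * L"] by simp
  then show ?thesis by (simp add: powr_def)
qed

text \<open>Rankin's method with \<open>z = 3/2\<close>: each counted \<open>m\<close> has weight at
  least \<open>exp (63/100 * L)\<close>, while the average weight is at most
  \<open>exp (59/100 * L)\<close>. The difference of the exponents is
  \<open>- L / 25\<close>.\<close>

lemma card_prime_mult_large:
  assumes "finite T" "\<And>p. p \<in> T \<Longrightarrow> prime p \<and> p \<ge> 10"
  defines "L \<equiv> (\<Sum>p\<in>T. 1 / real p)"
  shows "real (card {m\<in>{1..x}. 9/5 * L \<le> real (prime_mult T m)}) \<le> real x * exp (- L / 25)"
proof -
  let ?B = "{m\<in>{1..x}. 9/5 * L \<le> real (prime_mult T m)}"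
  have L0: "L \<ge> 0" unfolding L_def by (intro sum_nonneg) auto
  have "real (card ?B) * exp (63/100 * L) \<le> real (card ?B) * (3/2) powr (9/5 * L)"
    using exp_le_three_halves_powr[OF L0] by (intro mult_left_mono) auto
  also have "\<dots> = (\<Sum>m\<in>?B. (3/2) powr (9/5 * L))" by simp
  also have "\<dots> \<le> (\<Sum>m\<in>?B. (3/2) ^ prime_mult T m)"
  proof (intro sum_mono)
    fix m assume "m \<in> ?B"
    then show "(3/2) powr (9/5 * L) \<le> (3/2 :: real) ^ prime_mult T m"
      by (subst powr_realpow[symmetric]) (auto intro!: powr_mono)
  qed
  also have "\<dots> \<le> (\<Sum>m\<in>{1..x}. (3/2) ^ prime_mult T m)" by (intro sum_mono2) auto
  also have "\<dots> \<le> real x * (\<Prod>p\<in>T. 1 + (3/2 - 1) / (real p - 3/2))"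
    using assms(1,2) by (intro sum_power_prime_mult_le) force+
  also have "(\<Prod>p\<in>T. 1 + (3/2 - 1) / (real p - 3/2)) \<le> (\<Prod>p\<in>T. exp (59/100 * (1 / real p)))"
  proof (intro prod_mono conjI)
    fix p assume "p \<in> T"
    then have p: "real p \<ge> 10" using assms(2) by force
    \<comment> \<open>This is where \<open>p >= 10\<close> enters: the inequality amounts to
      \<open>9/100 * p >= 885/1000\<close>.\<close>
    then have "(3/2 - 1) / (real p - 3/2) \<le> 59/100 * (1 / real p)" by (simp add: field_simps)
    then show "1 + (3/2 - 1) / (real p - 3/2) \<le> exp (59/100 * (1 / real p))"
      using exp_ge_add_one_self[of "59/100 * (1 / real p)"] by linarith
    show "0 \<le> 1 + (3/2 - 1) / (real p - 3/2)" using p by simp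
  qed
  also have "(\<Prod>p\<in>T. exp (59/100 * (1 / real p))) = exp (59/100 * L)"
    using assms(1) by (simp add: exp_sum[symmetric] L_def sum_distrib_left)
  finally have "real (card ?B) * exp (63/100 * L) \<le> real x * exp (59/100 * L)"
    by (simp add: mult_left_mono)
  then have "real (card ?B) \<le> real x * exp (59/100 * L) / exp (63/100 * L)" by (simp add: field_simps)
  also have "\<dots> = real x * exp (59/100 * L - 63/100 * L)" by (simp only: exp_diff times_divide_eq_right)
  also have "59/100 * L - 63/100 * L = - L / 25" by simp
  finally show ?thesis .
qed

text \<open>The three conditions discard at most \<open>(1 + 1 + 2) / 64 = 1/16\<close> of the
  \<open>M^2\<close> pairs, the 2 because sums range up to \<open>2 * M\<close>; and
  \<open>1/4 - 1/16 >= 1/8\<close>.\<close>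

lemma card_coprime_pairs_avoiding_ge:
  assumes "\<And>x. x \<ge> M \<Longrightarrow> 64 * card {m\<in>{1..x}. bad m} \<le> x"
  shows "(real M)\<^sup>2 / 8 \<le> real (card {(p, q). p \<in> {1..M} \<and> q \<in> {1..M} \<and> coprime p q \<and>
            \<not> bad p \<and> \<not> bad q \<and> \<not> bad (p + q)})" (is "_ \<le> real (card ?Q)")
proof -
  let ?C = "{(p, q). p \<in> {1..M} \<and> q \<in> {1..M} \<and> coprime p q}"
  let ?b = "\<lambda>x. {m\<in>{1..x}. bad m}"
  \<comment> \<open>A pair with bad sum is determined by its sum and first entry. Truncated
    subtraction for \<open>s < p\<close> only enlarges the cover.\<close>
  let ?S = "(\<lambda>(s, p). (p, s - p)) ` (?b (2 * M) \<times> {1..M})"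
  have "?C \<subseteq> ?Q \<union> (?b M \<times> {1..M} \<union> {1..M} \<times> ?b M \<union> ?S)"
  proof
    fix u assume "u \<in> ?C"
    then obtain p q where u: "u = (p, q)" "p \<in> {1..M}" "q \<in> {1..M}" "coprime p q" by auto
    have "u = (\<lambda>(s, p). (p, s - p)) (p + q, p)" using u by simp
    then have "bad (p + q) \<Longrightarrow> u \<in> ?S" using u(2,3) by (intro image_eqI[of _ _ "(p + q, p)"]) auto
    then show "u \<in> ?Q \<union> (?b M \<times> {1..M} \<union> {1..M} \<times> ?b M \<union> ?S)" using u by auto
  qed
  moreover have finQ: "finite ?Q" by (rule finite_subset[of _ "{1..M} \<times> {1..M}"]) auto
  ultimately have "card ?C \<le> card (?Q \<union> (?b M \<times> {1..M} \<union> {1..M} \<times> ?b M \<union> ?S))"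
    by (intro card_mono) auto
  also have "\<dots> \<le> card ?Q + (card (?b M \<times> {1..M}) + card ({1..M} \<times> ?b M) + card ?S)"
    by (intro order.trans[OF card_Un_le] add_mono order.refl)
  also have "card ?S \<le> card (?b (2 * M) \<times> {1..M})" by (rule card_image_le) auto
  finally have "card ?C \<le> card ?Q + (card (?b M) * M + M * card (?b M) + card (?b (2 * M)) * M)"
    by (simp only: card_cartesian_product card_atLeastAtMost diff_Suc_1)
  then have "64 * card ?C \<le> 64 * card ?Q + ((64 * card (?b M)) * M + M * (64 * card (?b M)) + (64 * card (?b (2 * M))) * M)"
    by (simp add: algebra_simps)
  also have "\<dots> \<le> 64 * card ?Q + (M * M + M * M + (2 * M) * M)"
    by (intro add_mono[OF order.refl] add_mono mult_right_mono[OF assms] mult_left_mono[OF assms]) auto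
  finally have "real (64 * card ?C) \<le> real (64 * card ?Q + 4 * M * M)" by (subst of_nat_le_iff) simp
  then show ?thesis using card_coprime_pairs_ge[of M] by (simp add: power2_eq_square)
qed

text \<open>One set \<open>A\<close> serves both coordinates and their sum, since all three are
  products of two integers that are not bad. The slope \<open>q / p\<close> does not depend on
  \<open>k\<close>, so \<open>R\<close> stays small while \<open>G\<close> gains a factor of order
  \<open>X\<close>.\<close>

lemma sums_and_ratios_of_multiplication_table:
  assumes "finite T" "\<And>p. p \<in> T \<Longrightarrow> prime p \<and> p \<ge> 10" "card T \<le> M" "M \<le> X"
  defines "L \<equiv> (\<Sum>p\<in>T. 1 / real p)"
  assumes L: "L \<ge> 19200"
  shows "\<exists>(A :: real set) R G. finite A \<and> finite R \<and>
           real (card A) \<le> 2 * real X * real M * exp (- L / 25) \<and> card R \<le> M\<^sup>2 \<and>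
           real X * (real M)\<^sup>2 / 16 \<le> real (card G) \<and>
           (\<forall>x y. (x, y) \<in> G \<longrightarrow> x \<in> A \<and> y \<in> A \<and> x + y \<in> A \<and> x \<noteq> 0 \<and> y / x \<in> R)"
proof -
  define bad where "bad m \<longleftrightarrow> real (prime_mult T m) < 9/10 * L" for m
  have bad: "64 * card {m\<in>{1..x}. bad m} \<le> x" if "x \<ge> M" for x
  proof -
    have "real (card {m\<in>{1..x}. bad m}) \<le> 300 * real x / L"
      unfolding bad_def L_def using assms that L by (intro card_prime_mult_small) auto
    \<comment> \<open>The threshold is \<open>19200 = 300 * 64\<close>.\<close>
    also have "\<dots> \<le> 300 * real x / 19200" using L by (intro divide_left_mono) auto
    finally show ?thesis by simp
  qed
  define A where "A = {m\<in>{1..2 * X * M}. 9/5 * L \<le> real (prime_mult T m)}"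
  define R where "R = (\<lambda>(p, q). real q / real p) ` ({1..M} \<times> {1..M})"
  define K where "K = {k\<in>{1..X}. \<not> bad k}"
  define Q where "Q = {(p, q). p \<in> {1..M} \<and> q \<in> {1..M} \<and> coprime p q \<and> \<not> bad p \<and> \<not> bad q \<and> \<not> bad (p + q)}"
  define f where "f = (\<lambda>(k :: nat, p :: nat, q :: nat). (real (k * p), real (k * q)))"
  define G where "G = f ` (K \<times> Q)"
  have A: "k * m \<in> A" if "k \<in> K" "\<not> bad m" "1 \<le> m" "m \<le> 2 * M" for k m
  proof -
    have k: "1 \<le> k" "k \<le> X" "\<not> bad k" using that by (auto simp: K_def)
    have "k * m \<le> X * (2 * M)" using k that by (intro mult_mono) auto
    moreover have "prime_mult T (k * m) = prime_mult T k + prime_mult T m"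
      using assms(2) k that by (intro prime_mult_mult) auto
    ultimately show ?thesis using k that by (auto simp: A_def bad_def mult_ac)
  qed
  have "finite Q" unfolding Q_def by (rule finite_subset[of _ "{1..M} \<times> {1..M}"]) auto
  have card_K: "real X / 2 \<le> real (card K)"
  proof -
    have "card {m\<in>{1..X}. bad m} + card K = card ({m\<in>{1..X}. bad m} \<union> K)"
      by (subst card_Un_disjoint) (auto simp: K_def)
    also have "{m\<in>{1..X}. bad m} \<union> K = {1..X}" by (auto simp: K_def)
    finally show ?thesis using bad[OF assms(4)] by simp
  qed
  have card_Q: "(real M)\<^sup>2 / 8 \<le> real (card Q)"
    unfolding Q_def by (rule card_coprime_pairs_avoiding_ge[OF bad])
  have "inj_on f (K \<times> Q)"
  proof (rule inj_onI)
    fix u v assume uv: "u \<in> K \<times> Q" "v \<in> K \<times> Q" and eq: "f u = f v"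
    obtain k p q k' p' q' where u: "u = (k, p, q)" and v: "v = (k', p', q')"
      by (metis prod.exhaust)
    have kpq: "k \<in> K" "(p, q) \<in> Q" "k' \<in> K" "(p', q') \<in> Q" using uv u v by auto
    have eq': "k * p = k' * p'" "k * q = k' * q'"
      using eq unfolding u v by (simp_all only: f_def case_prod_conv prod.inject of_nat_eq_iff)
    have "coprime p q" "coprime p' q'" using kpq by (auto simp: Q_def)
    \<comment> \<open>Coprimality of \<open>p\<close> and \<open>q\<close> recovers \<open>k\<close>
      as the gcd of the coordinates, so no point is counted twice.\<close>
    then have "k = gcd (k * p) (k * q)" "k' = gcd (k' * p') (k' * q')"
      by (simp_all add: gcd_mult_distrib_nat[symmetric])
    then have "k = k'" using eq' by simp
    moreover have "k > 0" using kpq by (auto simp: K_def)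
    ultimately show "u = v" using eq' by (simp add: u v)
  qed
  then have "real (card G) = real (card K) * real (card Q)"
    by (simp add: G_def card_image card_cartesian_product)
  also have "\<dots> \<ge> real X / 2 * ((real M)\<^sup>2 / 8)" using card_K card_Q by (intro mult_mono) auto
  finally have card_G: "real X * (real M)\<^sup>2 / 16 \<le> real (card G)" by simp
  have G: "x \<in> real ` A \<and> y \<in> real ` A \<and> x + y \<in> real ` A \<and> x \<noteq> 0 \<and> y / x \<in> R" if "(x, y) \<in> G" for x y
  proof -
    obtain k p q where kpq: "k \<in> K" "(p, q) \<in> Q" "x = real (k * p)" "y = real (k * q)"
      using \<open>(x, y) \<in> G\<close> by (auto simp: G_def f_def)
    have pq: "1 \<le> p" "p \<le> M" "1 \<le> q" "q \<le> M" "\<not> bad p" "\<not> bad q" "\<not> bad (p + q)"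
      using kpq by (auto simp: Q_def)
    have "k > 0" using kpq by (auto simp: K_def)
    have "k * p \<in> A" "k * q \<in> A" "k * (p + q) \<in> A" using A[OF kpq(1)] pq by auto
    moreover have "x + y = real (k * (p + q))" using kpq by (simp add: algebra_simps)
    ultimately have "x \<in> real ` A" "y \<in> real ` A" "x + y \<in> real ` A"
      unfolding kpq(3,4) by (simp_all only: imageI)
    moreover have "y / x = (\<lambda>(p, q). real q / real p) (p, q)" using kpq \<open>k > 0\<close> by simp
    then have "y / x \<in> R" unfolding R_def using pq by (metis atLeastAtMost_iff image_eqI mem_Sigma_iff)
    moreover have "x \<noteq> 0" using kpq pq \<open>k > 0\<close> by simp
    ultimately show ?thesis by blast
  qed
  have "card R \<le> card ({1..M} \<times> {1..M})" unfolding R_def by (rule card_image_le) auto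
  then have card_R: "card R \<le> M\<^sup>2" by (simp add: power2_eq_square)
  have "real (card (real ` A)) = real (card A)" by (simp add: card_image)
  also have "\<dots> \<le> real (2 * X * M) * exp (- L / 25)"
    unfolding A_def L_def using assms by (intro card_prime_mult_large) auto
  finally have card_A: "real (card (real ` A)) \<le> 2 * real X * real M * exp (- L / 25)" by simp
  have "finite (real ` A)" "finite R" by (auto simp: A_def R_def)
  then show ?thesis using card_A card_R card_G G by blast
qed

section \<open>Choice of the parameters\<close>

lemma sum_large_prime_inverses_ge:
  assumes "M \<ge> 3"
  shows "ln (ln (real M)) / 2 - 4 \<le> (\<Sum>p | prime p \<and> 10 \<le> p \<and> p \<le> M. 1 / real p)" (is "_ \<le> ?L")
proof -
  have "(\<Sum>p | prime p \<and> p \<le> M. 1 / real p) \<le> (\<Sum>p\<in>{2..9} \<union> {p. prime p \<and> 10 \<le> p \<and> p \<le> M}. 1 / real p)"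
    by (intro sum_mono2) (auto dest: prime_ge_2_nat)
  also have "\<dots> = (\<Sum>p\<in>{2..9}. 1 / real p) + ?L" by (rule sum.union_disjoint) auto
  \<comment> \<open>Eight terms of at most 1/2 each give the loss of 4.\<close>
  also have "(\<Sum>p\<in>{2..9::nat}. 1 / real p) \<le> (\<Sum>p\<in>{2..9::nat}. 1 / 2)"
    by (intro sum_mono divide_left_mono) auto
  finally have "(\<Sum>p | prime p \<and> p \<le> M. 1 / real p) \<le> 4 + ?L" by simp
  then have "exp (2 * (\<Sum>p | prime p \<and> p \<le> M. 1 / real p)) \<le> exp (2 * (4 + ?L))" by simp
  moreover have "ln (real M) \<le> exp (2 * (\<Sum>p | prime p \<and> p \<le> M. 1 / real p))"
    using assms by (intro ln_le_exp_sum_prime_inverses) simp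
  ultimately have "ln (real M) \<le> exp (2 * (4 + ?L))" by linarith
  moreover have "ln (real M) > 0" using assms by simp
  ultimately have "ln (ln (real M)) \<le> 2 * (4 + ?L)" by (metis ln_exp ln_le_cancel_iff exp_gt_zero)
  then show ?thesis by simp
qed

text \<open>With \<open>E = exp (L / 25)\<close> and \<open>X\<close> about
  \<open>M * E / 2\<close>, the bound on \<open>card A\<close> becomes \<open>M^2 <= n\<close>. As
  \<open>L\<close> is at least \<open>ln (ln M) / 2 - 4\<close>, \<open>E\<close> grows at least
  like \<open>(ln M) powr (1/50)\<close>.\<close>

lemma eventually_sums_and_ratios:
  "\<exists>c c' :: real. c > 0 \<and> c' > 0 \<and>
     (\<forall>\<^sub>F n in sequentially. \<exists>(A :: real set) R G. finite A \<and> finite R \<and> card A \<le> n \<and> card R \<le> n \<and>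
        (\<forall>x y. (x, y) \<in> G \<longrightarrow> x \<in> A \<and> y \<in> A \<and> x + y \<in> A \<and> x \<noteq> 0 \<and> y / x \<in> R) \<and>
        c' * real n powr (3/2) * ln (real n) powr c \<le> real (card G))"
proof -
  \<comment> \<open>The losses: \<open>exp (- 4/25)\<close> from the 4 in the bound for
    \<open>L\<close>, 1/4 from \<open>ln M >= ln n / 4\<close>, and \<open>512 = 8 * 4 * 16\<close>
    from \<open>M >= sqrt n / 2\<close> cubed, \<open>X >= M * E / 4\<close> and the bound on
    \<open>card G\<close>.\<close>
  define c' :: real where "c' = exp (- 4/25) * (1/4) powr (1/50) / 512"
  \<comment> \<open>This gives \<open>ln (ln M) >= 38408 = 2 * (19200 + 4)\<close>, hence
    \<open>L >= 19200\<close>.\<close>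
  have "\<forall>\<^sub>F n in sequentially. real n \<ge> exp (4 * exp 38408)"
    using filterlim_real_sequentially by (simp add: filterlim_at_top)
  then have "\<forall>\<^sub>F n in sequentially. \<exists>(A :: real set) R G. finite A \<and> finite R \<and> card A \<le> n \<and> card R \<le> n \<and>
        (\<forall>x y. (x, y) \<in> G \<longrightarrow> x \<in> A \<and> y \<in> A \<and> x + y \<in> A \<and> x \<noteq> 0 \<and> y / x \<in> R) \<and>
        c' * real n powr (3/2) * ln (real n) powr (1/50) \<le> real (card G)"
  proof eventually_elim
    case (elim n)
    have "exp (38408 :: real) \<ge> 38409" using exp_ge_add_one_self[of 38408] by simp
    then have n1: "real n \<ge> 38409"
      using elim exp_ge_add_one_self[of "4 * exp 38408"] by linarith
    have ln_n: "ln (real n) \<ge> 4 * exp 38408" using elim n1 by (subst ln_ge_iff) auto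
    define M where "M = nat \<lfloor>sqrt (real n)\<rfloor>"
    have sqrt4: "sqrt (real n) \<ge> 4" using n1 by (intro real_le_rsqrt) simp
    have M: "real M \<le> sqrt (real n)" "real M \<ge> sqrt (real n) / 2" "M \<ge> 3"
      unfolding M_def using sqrt4 by linarith+
    have M2: "M\<^sup>2 \<le> n"
    proof -
      have "(real M)\<^sup>2 \<le> (sqrt (real n))\<^sup>2" using M by (intro power_mono) auto
      then have "real (M\<^sup>2) \<le> real n" by simp
      then show ?thesis by (simp only: of_nat_le_iff)
    qed
    have ln_M: "ln (real M) \<ge> ln (real n) / 4"
    proof -
      have "ln (real n) / 2 - ln 2 = ln (sqrt (real n) / 2)"
        using n1 by (simp add: ln_div ln_sqrt)
      also have "\<dots> \<le> ln (real M)" using M sqrt4 n1 by (subst ln_le_cancel_iff) auto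
      finally show ?thesis using ln_n \<open>exp 38408 \<ge> 38409\<close> ln_2_less_1 by simp
    qed
    define T where "T = {p. prime p \<and> 10 \<le> p \<and> p \<le> M}"
    define L where "L = (\<Sum>p\<in>T. 1 / real p)"
    have finT: "finite T" unfolding T_def by (rule finite_subset[of _ "{1..M}"]) auto
    have "card T \<le> card {1..M}" unfolding T_def by (intro card_mono) auto
    then have card_T: "card T \<le> M" by simp
    have L_ge: "L \<ge> ln (ln (real M)) / 2 - 4"
      unfolding L_def T_def using M by (intro sum_large_prime_inverses_ge)
    have lnM0: "ln (real M) > 0" using M by simp
    have "ln (real M) \<ge> exp 38408" using ln_M ln_n by simp
    then have "ln (ln (real M)) \<ge> 38408" using lnM0 by (subst ln_ge_iff)
    then have L: "L \<ge> 19200" using L_ge by simp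
    define E where "E = exp (L / 25)"
    have "E \<ge> exp 768" unfolding E_def using L by simp
    \<comment> \<open>\<open>E >= 4\<close> leaves room for the floor in \<open>X\<close>, giving
      both \<open>M <= X\<close> and \<open>X >= M * E / 4\<close>.\<close>
    then have E4: "E \<ge> 4" using exp_ge_add_one_self[of 768] by linarith
    define X where "X = nat \<lfloor>real M * E / 2\<rfloor>"
    have ME: "real M * E \<ge> real M * 4" using E4 by (intro mult_left_mono) auto
    have X: "real X \<le> real M * E / 2" "real X \<ge> real M * E / 4" "M \<le> X"
      unfolding X_def using ME M(3) by linarith+
    obtain A :: "real set" and R G where ARG: "finite A" "finite R"
       "real (card A) \<le> 2 * real X * real M * exp (- L / 25)" "card R \<le> M\<^sup>2"
       "real X * (real M)\<^sup>2 / 16 \<le> real (card G)"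
       "\<forall>x y. (x, y) \<in> G \<longrightarrow> x \<in> A \<and> y \<in> A \<and> x + y \<in> A \<and> x \<noteq> 0 \<and> y / x \<in> R"
      using sums_and_ratios_of_multiplication_table[of T M X] finT card_T X L unfolding L_def T_def by blast
    have "real (card A) \<le> 2 * (real M * E / 2) * real M * exp (- L / 25)"
      using ARG(3) X(1) by (elim order.trans) (intro mult_right_mono mult_left_mono, auto)
    also have "\<dots> = real (M\<^sup>2)" by (simp add: E_def exp_minus power2_eq_square)
    finally have "card A \<le> M\<^sup>2" by (simp only: of_nat_le_iff)
    have "exp (- 4/25) * (ln (real n) / 4) powr (1/50) \<le> exp (- 4/25) * ln (real M) powr (1/50)"
      using ln_M ln_n by (intro mult_left_mono powr_mono2) (auto intro: order.trans[of _ "4 * exp 38408"])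
    also have "\<dots> = exp ((ln (ln (real M)) / 2 - 4) / 25)"
      using lnM0 by (simp add: powr_def exp_add[symmetric] diff_divide_distrib)
    also have "\<dots> \<le> E" unfolding E_def using L_ge by simp
    finally have E_ge: "exp (- 4/25) * (ln (real n) / 4) powr (1/50) \<le> E" .
    have "(ln (real n) / 4) powr (1/50) = ln (real n) powr (1/50) * (1/4) powr (1/50)"
      using n1 by (subst powr_mult[symmetric]) auto
    then have "c' * real n powr (3/2) * ln (real n) powr (1/50)
        = real n powr (3/2) / 512 * (exp (- 4/25) * (ln (real n) / 4) powr (1/50))"
      by (simp add: c'_def)
    also have "\<dots> \<le> real n powr (3/2) / 512 * E"
      using E_ge by (intro mult_left_mono) auto
    also have "\<dots> = (sqrt (real n) / 2) ^ 3 * E / 64"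
    proof -
      have "real n powr (3/2) = (sqrt (real n)) ^ 3"
        using n1 by (simp add: powr_half_sqrt[symmetric] powr_powr flip: powr_realpow)
      then show ?thesis by (simp add: power_divide)
    qed
    also have "\<dots> \<le> (real M) ^ 3 * E / 64"
      using M(2) E4 by (intro divide_right_mono mult_right_mono power_mono) auto
    also have "\<dots> = (real M * E / 4) * (real M)\<^sup>2 / 16"
      by (simp add: power2_eq_square power3_eq_cube)
    also have "\<dots> \<le> real X * (real M)\<^sup>2 / 16"
      using X(2) by (intro divide_right_mono mult_right_mono) auto
    also have "\<dots> \<le> real (card G)" by (rule ARG(5))
    finally have "c' * real n powr (3/2) * ln (real n) powr (1/50) \<le> real (card G)" .
    moreover have "card A \<le> n" "card R \<le> n" using \<open>card A \<le> M\<^sup>2\<close> ARG(4) M2 by linarith+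
    ultimately show ?case using ARG(1,2,6) by blast
  qed
  moreover have "c' > 0" by (simp add: c'_def)
  ultimately show ?thesis by (intro exI[of _ "1/50"] exI[of _ c']) auto
qed

subsection \<open>Pencils in coordinates\<close>

definition coord_point :: "real \<Rightarrow> real \<Rightarrow> real \<Rightarrow> (real^3) set" where
  "coord_point x y z = span {vector [x, y, z]}"

definition coord_line :: "real \<Rightarrow> real \<Rightarrow> real \<Rightarrow> (real^3) set" where
  "coord_line a b c = {v. a * v$1 + b * v$2 + c * v$3 = 0}"

lemma coord_line_eq_hyperplane: "coord_line a b c = {v. vector [a, b, c] \<bullet> v = 0}"
  by (auto simp: coord_line_def inner_vec_def sum_3)

lemma vector_3_eq_0_iff: "vector [a, b, c] = (0 :: real^3) \<longleftrightarrow> a = 0 \<and> b = 0 \<and> c = 0"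
  by (auto simp: vec_eq_iff forall_3)

lemma proj_line_coord_line:
  assumes "a \<noteq> 0 \<or> b \<noteq> 0 \<or> c \<noteq> 0"
  shows "proj_line (coord_line a b c)"
proof -
  have "vector [a, b, c] \<noteq> (0 :: real^3)" using assms by (simp add: vector_3_eq_0_iff)
  then show ?thesis
    unfolding proj_line_def coord_line_eq_hyperplane
    by (simp add: dim_hyperplane subspace_hyperplane)
qed

lemma proj_point_coord_point:
  assumes "x \<noteq> 0 \<or> y \<noteq> 0 \<or> z \<noteq> 0"
  shows "proj_point (coord_point x y z)"
proof -
  have "vector [x, y, z] \<noteq> (0 :: real^3)" using assms by (simp add: vector_3_eq_0_iff)
  then show ?thesis
    unfolding proj_point_def coord_point_def by simp
qed

lemma coord_point_subset_coord_line_iff: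
  "coord_point x y z \<subseteq> coord_line a b c \<longleftrightarrow> a * x + b * y + c * z = 0"
proof -
  have "subspace (coord_line a b c)"
    unfolding coord_line_eq_hyperplane by (rule subspace_hyperplane)
  then have "coord_point x y z \<subseteq> coord_line a b c \<longleftrightarrow> vector [x, y, z] \<in> coord_line a b c"
    unfolding coord_point_def by (meson empty_subsetI insert_subset span_minimal span_superset order.trans)
  then show ?thesis by (simp add: coord_line_def)
qed

lemma lies_on_coord_iff:
  assumes "x \<noteq> 0 \<or> y \<noteq> 0 \<or> z \<noteq> 0" "a \<noteq> 0 \<or> b \<noteq> 0 \<or> c \<noteq> 0"
  shows "lies_on (coord_point x y z) (coord_line a b c) \<longleftrightarrow> a * x + b * y + c * z = 0"
  using assms
  by (simp add: lies_on_def proj_point_coord_point proj_line_coord_line coord_point_subset_coord_line_iff)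

text \<open>Used to separate points by a line through one that misses the other; the next lemma is
  the dual for lines.\<close>

lemma coord_point_eqD:
  assumes "coord_point x y z = coord_point x' y' z'" "a * x + b * y + c * z = 0"
  shows "a * x' + b * y' + c * z' = 0"
  using assms coord_point_subset_coord_line_iff by metis

lemma coord_line_eqD:
  assumes "coord_line a b c = coord_line a' b' c'" "a * x + b * y + c * z = 0"
  shows "a' * x + b' * y + c' * z = 0"
  using assms coord_point_subset_coord_line_iff by metis

lemma proj_point_obtain:
  assumes "proj_point q"
  obtains v where "v \<in> q" "v \<noteq> 0" "q = span {v}"
proof -
  have "\<not> q \<subseteq> {0}" using assms dim_eq_0[of q] by (auto simp: proj_point_def)
  then obtain v where v: "v \<in> q" "v \<noteq> 0" by auto
  have "span {v} \<subseteq> q" using v assms by (intro span_minimal) (auto simp: proj_point_def)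
  moreover have "dim (span {v}) \<ge> dim q" using v assms by (simp add: proj_point_def)
  ultimately have "span {v} = q"
    using assms by (intro subspace_dim_equal) (auto simp: proj_point_def)
  then show ?thesis using that v by blast
qed

section \<open>Construction of the four pencils\<close>

text \<open>Pads a parameter set to exactly \<open>n\<close> elements, as \<open>n_pencil\<close>
  demands; added lines cannot destroy richness.\<close>

lemma finite_superset_card:
  fixes A :: "'a set"
  assumes "finite A" "card A \<le> n" "infinite (UNIV :: 'a set)"
  obtains B where "A \<subseteq> B" "finite B" "card B = n"
proof -
  have "infinite (UNIV - A)" using assms by simp
  then obtain C where C: "finite C" "card C = n - card A" "C \<subseteq> UNIV - A"
    using infinite_arbitrarily_large by blast
  have "card (A \<union> C) = n" using assms C by (subst card_Un_disjoint) auto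
  then show ?thesis using that[of "A \<union> C"] assms C by auto
qed

lemma n_pencil_image:
  fixes f :: "real \<Rightarrow> (real^3) set"
  assumes "inj f" "\<And>r. lies_on p (f r)" "finite B" "card B = n"
  shows "n_pencil n p (f ` B)"
  using assms card_image[of f B] unfolding n_pencil_def
  by (auto simp: lies_on_def inj_on_subset)

lemma all_less_4: "(\<forall>i<4. P i) \<longleftrightarrow> P (0::nat) \<and> P 1 \<and> P 2 \<and> P 3"
  by (auto simp: less_Suc_eq numeral_eq_Suc)

lemma four_pencils_of_sums_and_ratios:
  fixes A B S R :: "real set" and G :: "(real \<times> real) set"
  assumes fin: "finite A" "finite B" "finite S" "finite R"
    and card: "card A \<le> n" "card B \<le> n" "card S \<le> n" "card R \<le> n"
    and G: "\<And>x y. (x, y) \<in> G \<Longrightarrow> x \<in> A \<and> y \<in> B \<and> x + y \<in> S \<and> x \<noteq> 0 \<and> y / x \<in> R"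
  shows "\<exists>(p :: nat \<Rightarrow> (real^3) set) (L :: nat \<Rightarrow> (real^3) set set).
          (\<forall>i<4. n_pencil n (p i) (L i)) \<and>
          inj_on p {..<4} \<and>
          \<not> (\<exists>l. proj_line l \<and> (\<forall>i<4. lies_on (p i) l)) \<and>
          finite (four_rich_points L) \<and>
          card G \<le> card (four_rich_points L)"
proof -
  have inf: "infinite (UNIV :: real set)" by (rule infinite_UNIV_char_0)
  obtain A' where A': "A \<subseteq> A'" "finite A'" "card A' = n"
    using finite_superset_card[OF fin(1) card(1) inf] .
  obtain B' where B': "B \<subseteq> B'" "finite B'" "card B' = n"
    using finite_superset_card[OF fin(2) card(2) inf] .
  obtain S' where S': "S \<subseteq> S'" "finite S'" "card S' = n"
    using finite_superset_card[OF fin(3) card(3) inf] .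
  obtain R' where R': "R \<subseteq> R'" "finite R'" "card R' = n"
    using finite_superset_card[OF fin(4) card(4) inf] .
  define p where "p = nth [coord_point 1 0 0, coord_point 0 1 0, coord_point 1 (-1) 0, coord_point 0 0 1]"
  \<comment> \<open>In the chart \<open>z = 1\<close> these are the lines \<open>y = b\<close>,
    \<open>x = a\<close>, \<open>x + y = s\<close> and \<open>y = r * x\<close>, in the order of the
    centres.\<close>
  define L where "L = nth [(\<lambda>b. coord_line 0 1 (-b)) ` B', (\<lambda>a. coord_line 1 0 (-a)) ` A',
    (\<lambda>s. coord_line 1 1 (-s)) ` S', (\<lambda>r. coord_line r (-1) 0) ` R']"
  have p [simp]: "p 0 = coord_point 1 0 0" "p 1 = coord_point 0 1 0" "p (Suc 0) = coord_point 0 1 0"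
      "p 2 = coord_point 1 (-1) 0" "p 3 = coord_point 0 0 1"
    by (simp_all add: p_def numeral_eq_Suc)
  have L [simp]: "L 0 = (\<lambda>b. coord_line 0 1 (-b)) ` B'" "L 1 = (\<lambda>a. coord_line 1 0 (-a)) ` A'"
      "L (Suc 0) = (\<lambda>a. coord_line 1 0 (-a)) ` A'"
      "L 2 = (\<lambda>s. coord_line 1 1 (-s)) ` S'" "L 3 = (\<lambda>r. coord_line r (-1) 0) ` R'"
    by (simp_all add: L_def numeral_eq_Suc)
  have inj: "inj (\<lambda>b. coord_line 0 1 (-b))" "inj (\<lambda>a. coord_line 1 0 (-a))"
      "inj (\<lambda>s. coord_line 1 1 (-s))" "inj (\<lambda>r. coord_line r (-1) 0)"
    subgoal by (rule injI) (drule coord_line_eqD[where x = 0 and z = 1], auto)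
    subgoal by (rule injI) (drule coord_line_eqD[where y = 0 and z = 1], auto)
    subgoal by (rule injI) (drule coord_line_eqD[where y = 0 and z = 1], auto)
    subgoal by (rule injI) (drule coord_line_eqD[where x = 1 and z = 0], auto)
    done
  have pencils: "\<forall>i<4. n_pencil n (p i) (L i)"
    unfolding all_less_4 using A' B' S' R' inj by (auto intro!: n_pencil_image simp: lies_on_coord_iff)
  have "coord_point 1 0 0 \<noteq> coord_point 0 1 0" "coord_point 1 0 0 \<noteq> coord_point 0 0 1"
      "coord_point 0 1 0 \<noteq> coord_point 0 0 1"
      "coord_point 1 0 0 \<noteq> coord_point 1 (-1) 0" "coord_point 0 1 0 \<noteq> coord_point 1 (-1) 0"
      "coord_point 0 0 1 \<noteq> coord_point 1 (-1) 0"
    using coord_point_eqD[of 1 0 0 0 1 0 0 1 0] coord_point_eqD[of 1 0 0 0 0 1 0 0 1]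
      coord_point_eqD[of 0 1 0 0 0 1 0 0 1] coord_point_eqD[of 1 0 0 1 "-1" 0 0 1 0]
      coord_point_eqD[of 0 1 0 1 "-1" 0 1 0 0] coord_point_eqD[of 0 0 1 1 "-1" 0 1 0 0]
    by auto
  then have "\<forall>i<4. \<forall>j<4. p i = p j \<longrightarrow> i = j"
    unfolding all_less_4 by auto
  then have inj_p: "inj_on p {..<4}" by (simp add: inj_on_def)
  \<comment> \<open>The centres 0, 1 and 3 are the coordinate axes, which already span the whole
    space.\<close>
  have noncol: False if l: "proj_line l" "\<forall>i<4. lies_on (p i) l" for l
  proof -
    have sub: "subspace l" using l by (simp add: proj_line_def)
    have "vector [1, 0, 0] \<in> l" "vector [0, 1, 0] \<in> l" "vector [0, 0, 1] \<in> l"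
      using l unfolding all_less_4 by (auto simp: lies_on_def coord_point_def intro: span_base)
    then have "v$1 *\<^sub>R vector [1, 0, 0] + v$2 *\<^sub>R vector [0, 1, 0] + v$3 *\<^sub>R vector [0, 0, 1] \<in> l" for v :: "real^3"
      using sub by (intro subspace_add subspace_scale)
    moreover have "v$1 *\<^sub>R vector [1, 0, 0] + v$2 *\<^sub>R vector [0, 1, 0] + v$3 *\<^sub>R vector [0, 0, 1] = v" for v :: "real^3"
      by (simp add: vec_eq_iff forall_3)
    ultimately have "l = UNIV" by (metis UNIV_eq_I)
    then show False using l by (simp add: proj_line_def)
  qed
  \<comment> \<open>Every rich point is the intersection of a horizontal and a vertical line. This
    finiteness matters because \<open>card\<close> of an infinite set is 0.\<close>
  have "four_rich_points L \<subseteq> (\<lambda>(a, b). coord_point a b 1) ` (A' \<times> B')"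
  proof
    fix q assume q: "q \<in> four_rich_points L"
    then obtain v where v: "v \<in> q" "v \<noteq> 0" "q = span {v}"
      using proj_point_obtain by (auto simp: four_rich_points_def)
    obtain a b s r where ab: "a \<in> A'" "b \<in> B'" and
        on: "lies_on q (coord_line 0 1 (-b))" "lies_on q (coord_line 1 0 (-a))"
      using q unfolding four_rich_points_def all_less_4 by auto
    then have v12: "v$2 = b * v$3" "v$1 = a * v$3" using v(1) by (auto simp: lies_on_def coord_line_def)
    have "v$3 \<noteq> 0" using v(2) v12 by (auto simp: vec_eq_iff forall_3)
    have eq: "v = v$3 *\<^sub>R vector [a, b, 1]" using v12 by (simp add: vec_eq_iff forall_3)
    have "span {v$3 *\<^sub>R vector [a, b, 1 :: real] :: real^3} = span {vector [a, b, 1]}"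
      using \<open>v$3 \<noteq> 0\<close> span_image_scale[of "{vector [a, b, 1]}" "\<lambda>_. v$3"] by simp
    then have "q = coord_point a b 1" using eq v(3) by (metis coord_point_def)
    then show "q \<in> (\<lambda>(a, b). coord_point a b 1) ` (A' \<times> B')" using ab by auto
  qed
  then have fin_rich: "finite (four_rich_points L)" by (rule finite_subset) (use A' B' in auto)
  have "(\<lambda>(a, b). coord_point a b 1) ` G \<subseteq> four_rich_points L"
  proof clarify
    fix x y assume xy: "(x, y) \<in> G"
    have g: "x \<in> A'" "y \<in> B'" "x + y \<in> S'" "x \<noteq> 0" "y / x \<in> R'" using G[OF xy] A' B' S' R' by auto
    have "lies_on (coord_point x y 1) (coord_line 0 1 (-y))" "lies_on (coord_point x y 1) (coord_line 1 0 (-x))"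
      "lies_on (coord_point x y 1) (coord_line 1 1 (-(x + y)))" "lies_on (coord_point x y 1) (coord_line (y / x) (-1) 0)"
      using g(4) by (auto simp: lies_on_coord_iff)
    then show "coord_point x y 1 \<in> four_rich_points L"
      unfolding four_rich_points_def all_less_4 using g(1-3,5) by (auto simp: proj_point_coord_point simp del: minus_add_distrib)
  qed
  then have "card ((\<lambda>(a, b). coord_point a b 1) ` G) \<le> card (four_rich_points L)"
    using fin_rich by (intro card_mono)
  moreover have "inj_on (\<lambda>(a, b). coord_point a b 1) G"
  proof (rule inj_onI, clarify)
    fix a b a' b' assume "coord_point a b 1 = coord_point a' b' 1"
    then show "a = a' \<and> b = b'"
      using coord_point_eqD[of a b 1 a' b' 1 1 0 "-a"] coord_point_eqD[of a b 1 a' b' 1 0 1 "-b"] by simp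
  qed
  ultimately have "card G \<le> card (four_rich_points L)" by (simp add: card_image)
  then show ?thesis using pencils inj_p noncol fin_rich by blast
qed

theorem theorem2:
  "\<exists>c c' :: real. c > 0 \<and> c' > 0 \<and>
     (\<forall>\<^sub>F n in sequentially.
        \<exists>(p :: nat \<Rightarrow> (real^3) set) (L :: nat \<Rightarrow> (real^3) set set).
          (\<forall>i<4. n_pencil n (p i) (L i)) \<and>
          inj_on p {..<4} \<and>
          \<not> (\<exists>l. proj_line l \<and> (\<forall>i<4. lies_on (p i) l)) \<and>
          finite (four_rich_points L) \<and>
          real (card (four_rich_points L)) \<ge> c' * real n powr (3/2) * ln (real n) powr c)"
proof -
  obtain c c' :: real where c: "c > 0" "c' > 0"
    and ev: "\<forall>\<^sub>F n in sequentially. \<exists>(A :: real set) R G. finite A \<and> finite R \<and> card A \<le> n \<and> card R \<le> n \<and>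
        (\<forall>x y. (x, y) \<in> G \<longrightarrow> x \<in> A \<and> y \<in> A \<and> x + y \<in> A \<and> x \<noteq> 0 \<and> y / x \<in> R) \<and>
        c' * real n powr (3/2) * ln (real n) powr c \<le> real (card G)"
    using eventually_sums_and_ratios by blast
  show ?thesis
  proof (intro exI conjI)
    show "c > 0" "c' > 0" by (fact c)+
    show "\<forall>\<^sub>F n in sequentially.
        \<exists>(p :: nat \<Rightarrow> (real^3) set) (L :: nat \<Rightarrow> (real^3) set set).
          (\<forall>i<4. n_pencil n (p i) (L i)) \<and>
          inj_on p {..<4} \<and>
          \<not> (\<exists>l. proj_line l \<and> (\<forall>i<4. lies_on (p i) l)) \<and>
          finite (four_rich_points L) \<and>
          real (card (four_rich_points L)) \<ge> c' * real n powr (3/2) * ln (real n) powr c"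
      using ev
    proof eventually_elim
      case (elim n)
      then obtain A R :: "real set" and G where "finite A" "finite R" "card A \<le> n" "card R \<le> n"
        and "\<And>x y. (x, y) \<in> G \<Longrightarrow> x \<in> A \<and> y \<in> A \<and> x + y \<in> A \<and> x \<noteq> 0 \<and> y / x \<in> R"
        and G: "c' * real n powr (3/2) * ln (real n) powr c \<le> real (card G)"
        by blast
      \<comment> \<open>The same \<open>A\<close> parametrizes the horizontal, vertical and diagonal
        pencils.\<close>
      then obtain p L where "\<forall>i<4. n_pencil n (p i) (L i)" "inj_on p {..<4}"
          "\<not> (\<exists>l. proj_line l \<and> (\<forall>i<4. lies_on (p i) l))" "finite (four_rich_points L)"
          "card G \<le> card (four_rich_points L)"
        using four_pencils_of_sums_and_ratios[of A A A R n G] by blast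
      moreover from this G have "c' * real n powr (3/2) * ln (real n) powr c \<le> real (card (four_rich_points L))"
        by linarith
      ultimately show ?case by blast
    qed
  qed
qed

end
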